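(* For every integer $n\geq 0$, the polynomial $$\prod_{k=0}^{n}(1+q^{3k+1})(1+q^{3k+2})$$ in the variable $q$ is symmetric and unimodal.
   Context: A polynomial $a_0+a_1q+\cdots+a_Nq^N$ with integer coefficients is called unimodal if for some $0\leq j\leq N$, $$a_0\leq a_1\leq\cdots\leq a_j\geq a_{j+1}\geq\cdots\geq a_N,$$ and is called symmetric if $a_j=a_{N-j}$ for all $0\leq j\leq N$. Here the polynomial is regarded with $N$ equal to its degree, which for the polynomial in the claim is $N=3(n+1)^2$. *)

theory Defs
  imports "HOL-Computational_Algebra.Polynomial"
begin

(* In both definitions a polynomial a_0 + a_1 q + ... + a_N q^N is read with N = degree p. *)

definition unimodal_poly :: "int poly \<Rightarrow> bool" where
  "unimodal_poly p \<longleftrightarrow>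
     (\<exists>j\<le>degree p.
        (\<forall>i<j. coeff p i \<le> coeff p (i + 1)) \<and>
        (\<forall>i. j \<le> i \<and> i < degree p \<longrightarrow> coeff p i \<ge> coeff p (i + 1)))"

definition symmetric_poly :: "int poly \<Rightarrow> bool" where
  "symmetric_poly p \<longleftrightarrow> (\<forall>j\<le>degree p. coeff p j = coeff p (degree p - j))"

end

theory Submission
  imports Defs "HOL-Analysis.Analysis"
begin

text \<open>
  By Euler's formula the coefficients of \<open>(1 - q) P\<^sub>M(q)\<close>, where \<open>P\<^sub>M\<close> is the product of the first \<open>M\<close>
  pairs of factors, of degree \<open>3M\<^sup>2\<close>, are up to a positive constant the integrals over \<open>[0, \<pi>/2]\<close> of
  \<open>f(x) sin x sin(sx)\<close> with \<open>s = 3M\<^sup>2 + 1 - 2i\<close> and \<open>f(x) = \<Prod> cos(jx)\<close>, \<open>j\<close> ranging over the exponents.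
  By symmetry it suffices that they are nonnegative for \<open>s \<ge> 0\<close>. Passing from \<open>M\<close> to \<open>M + 1\<close>,
  nonnegativity is inherited termwise except in the window \<open>s \<le> 6M + 2\<close> below the middle. In this
  window the integrand is nonnegative on \<open>[0, \<pi>/(6M + 6)]\<close>, where the part near 0 contributes a
  multiple of \<open>s M\<^sup>-\<^sup>9\<^sup>/\<^sup>2\<close>; on the rest \<open>f\<close> is exponentially small, because the sum of the
  \<open>cos(2jx)\<close> has a closed form. This settles \<open>M \<ge> 40\<close>; smaller \<open>M\<close> are computed.
\<close>


section \<open>Estimates for the cosine product\<close>

lemma sin_ge_cubic:
  fixes u :: real
  assumes "0 \<le> u"
  shows "u - u ^ 3 / 6 \<le> sin u"
proof -
  have "6 * \<bar>sin u - u\<bar> \<le> u ^ 3"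
    using Maclaurin_sin_bound[of u 3] assms
    by (simp add: eval_nat_numeral sin_coeff_def fact_numeral field_simps)
  moreover have "u - sin u \<le> \<bar>sin u - u\<bar>" by simp
  ultimately show ?thesis by simp
qed

lemma cos_ge_quadratic: "1 - u\<^sup>2 / 2 \<le> cos (u :: real)"
proof -
  have "cos u = 1 - 2 * (sin (u / 2))\<^sup>2"
    using cos_double_sin[of "u / 2"] by simp
  moreover have "(sin (u / 2))\<^sup>2 \<le> (u / 2)\<^sup>2"
    using abs_sin_x_le_abs_x[of "u / 2"] unfolding abs_le_square_iff .
  ultimately show ?thesis by (simp add: power_divide)
qed

definition cos_prod :: "nat \<Rightarrow> real \<Rightarrow> real" where
  "cos_prod M x = (\<Prod>k<M. cos ((3 * real k + 1) * x) * cos ((3 * real k + 2) * x))"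

text \<open>The doubled angles come from cos^2 t = (1 + cos 2t)/2: an upper bound on this sum bounds
  the square of \<open>cos_prod\<close>.\<close>

definition cos_sum :: "nat \<Rightarrow> real \<Rightarrow> real" where
  "cos_sum M x = (\<Sum>k<M. cos (2 * ((3 * real k + 1) * x)) + cos (2 * ((3 * real k + 2) * x)))"

lemma continuous_on_cos_prod [continuous_intros]: "continuous_on S (cos_prod M)"
  unfolding cos_prod_def by (intro continuous_intros)

text \<open>The largest frequency is 3M - 1, so the second hypothesis keeps all arguments in
  [0, pi/2].\<close>

lemma cos_prod_nonneg:
  assumes "0 \<le> x" "(6 * real M - 2) * x \<le> pi"
  shows "0 \<le> cos_prod M x"
  unfolding cos_prod_def
proof (intro prod_nonneg mult_nonneg_nonneg cos_ge_zero ballI)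
  fix k assume "k \<in> {..<M}"
  hence k: "real k + 1 \<le> real M" by simp
  have *: "(3 * real k + c) * x \<le> pi / 2" if "c \<le> 2" for c
  proof -
    have "2 * ((3 * real k + c) * x) = (6 * real k + 2 * c) * x" by (simp add: algebra_simps)
    also have "\<dots> \<le> (6 * real M - 2) * x"
      using k that assms by (intro mult_right_mono) auto
    finally show ?thesis using assms by simp
  qed
  show "(3 * real k + 1) * x \<le> pi / 2" "(3 * real k + 2) * x \<le> pi / 2"
    by (rule *; simp)+
  have "- (pi / 2) \<le> 0" by simp
  also have "0 \<le> (3 * real k + 1) * x" using assms by simp
  finally show "- (pi / 2) \<le> (3 * real k + 1) * x" .
  have "- (pi / 2) \<le> 0" by simp
  also have "0 \<le> (3 * real k + 2) * x" using assms by simp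
  finally show "- (pi / 2) \<le> (3 * real k + 2) * x" .
qed

lemma abs_cos_prod_le_1: "\<bar>cos_prod M x\<bar> \<le> 1"
  unfolding cos_prod_def abs_prod
  by (rule prod_le_1) (auto simp: abs_mult intro!: mult_le_one)

lemma mult_one_minus_le:
  fixes a b u v :: real
  assumes "1 - a \<le> u" "1 - b \<le> v" "0 \<le> u" "v \<le> 1" "u \<le> 1"
  shows "1 - (a + b) \<le> u * v"
proof -
  have "0 \<le> (1 - u) * (1 - v)" using assms by simp
  thus ?thesis using assms by (simp add: algebra_simps)
qed

text \<open>Weierstrass' product inequality, with cos u >= 1 - u^2/2 for each factor; 6M^3 - M is
  the sum of the squares of the frequencies.\<close>

lemma cos_prod_ge:
  assumes "0 \<le> x" "(6 * real M - 2) * x \<le> pi"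
  shows "1 - (6 * real M ^ 3 - real M) / 2 * x\<^sup>2 \<le> cos_prod M x"
  using assms
proof (induction M)
  case 0
  thus ?case by (simp add: cos_prod_def)
next
  case (Suc M)
  have le: "(6 * real M - 2) * x \<le> pi"
    by (rule order_trans[OF _ Suc.prems(2)]) (use Suc.prems in \<open>auto intro!: mult_right_mono\<close>)
  define c d where "c = cos ((3 * real M + 1) * x)" and "d = cos ((3 * real M + 2) * x)"
  have 1: "0 \<le> cos_prod M x" "cos_prod M x \<le> 1"
    using cos_prod_nonneg[OF Suc.prems(1) le] abs_cos_prod_le_1[of M x] by auto
  have eq: "cos_prod (Suc M) x = cos_prod M x * (c * d)"
    by (simp add: cos_prod_def c_def d_def)
  have arg: "(3 * real M + 1) * x \<le> pi / 2"
  proof -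
    have "2 * ((3 * real M + 1) * x) = (6 * real M + 2) * x" by (simp add: algebra_simps)
    also have "\<dots> \<le> (6 * real (Suc M) - 2) * x"
      using Suc.prems by (intro mult_right_mono) auto
    finally show ?thesis using Suc.prems by simp
  qed
  have c0: "0 \<le> c" unfolding c_def
  proof (rule cos_ge_zero[OF _ arg])
    have "- (pi / 2) \<le> 0" by simp
    also have "0 \<le> (3 * real M + 1) * x" using Suc.prems by simp
    finally show "- (pi / 2) \<le> (3 * real M + 1) * x" .
  qed
  have "1 - (((3 * real M + 1) * x)\<^sup>2 / 2 + ((3 * real M + 2) * x)\<^sup>2 / 2) \<le> c * d"
    by (rule mult_one_minus_le) (use c0 cos_ge_quadratic in \<open>auto simp: c_def d_def\<close>)
  moreover have "c * d \<le> 1"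
  proof -
    have "\<bar>c * d\<bar> \<le> 1" by (auto simp: c_def d_def abs_mult intro!: mult_le_one)
    thus ?thesis by simp
  qed
  ultimately have "1 - ((6 * real M ^ 3 - real M) / 2 * x\<^sup>2
      + (((3 * real M + 1) * x)\<^sup>2 / 2 + ((3 * real M + 2) * x)\<^sup>2 / 2)) \<le> cos_prod M x * (c * d)"
    using Suc.IH[OF Suc.prems(1) le] 1 by (intro mult_one_minus_le[of _ "cos_prod M x" _ "c * d"])
  also have "(6 * real M ^ 3 - real M) / 2 * x\<^sup>2
      + (((3 * real M + 1) * x)\<^sup>2 / 2 + ((3 * real M + 2) * x)\<^sup>2 / 2)
      = (6 * real (Suc M) ^ 3 - real (Suc M)) / 2 * x\<^sup>2"
    by (simp add: power2_eq_square power3_eq_cube field_simps)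
  finally show ?case by (simp add: eq)
qed

section \<open>Upper bound for the cosine product away from 0\<close>

lemma sin_times_cos_sum: "sin (3 * x) * cos_sum M x = cos x * sin (6 * real M * x)"
proof (induction M)
  case 0
  thus ?case by (simp add: cos_sum_def)
next
  case (Suc M)
  \<comment> \<open>With \<open>y\<close> as the mean of the two doubled angles, the pair becomes 2
    cos y cos x, and multiplication by sin(3x) makes the sum telescope.\<close>
  define y where "y = (6 * real M + 3) * x"
  have "cos (2 * ((3 * real M + 1) * x)) + cos (2 * ((3 * real M + 2) * x))
      = cos (y - x) + cos (y + x)"
    by (simp add: y_def algebra_simps)
  also have "\<dots> = 2 * cos y * cos x" by (simp add: cos_add cos_diff)
  finally have "sin (3 * x) * cos_sum (Suc M) x
      = cos x * (sin (6 * real M * x) + 2 * (sin (3 * x) * cos y))"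
    using Suc.IH by (simp add: cos_sum_def algebra_simps)
  also have "2 * (sin (3 * x) * cos y) = sin (y + 3 * x) - sin (y - 3 * x)"
    by (simp add: sin_add sin_diff)
  also have "y + 3 * x = 6 * real (Suc M) * x"
    by (simp add: y_def algebra_simps)
  also have "y - 3 * x = 6 * real M * x"
    by (simp add: y_def algebra_simps)
  finally show ?case by simp
qed

text \<open>The tangent \<open>1 + c \<le> 1.17 exp ((c - 0.17) / 1.17)\<close> at \<open>c = 0.17\<close> is chosen so that the
  exponential factors multiply to at most 1.\<close>
lemma cos_prod_squared_le:
  assumes "cos_sum M x \<le> 0.34 * real M"
  shows "(cos_prod M x)\<^sup>2 \<le> 0.342225 ^ M"
proof -
  \<comment> \<open>Each cosine of a pair contributes 0.585 = 1.17/2 to the bound, and 0.342225 =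
    0.585^2.\<close>
  define E :: "real \<Rightarrow> real" where "E t = exp ((cos (2 * t) - 0.17) / 1.17)" for t
  have E: "(cos t)\<^sup>2 \<le> 0.585 * E t" for t
  proof -
    have "1 + (cos (2 * t) - 0.17) / 1.17 \<le> E t"
      unfolding E_def by (rule exp_ge_add_one_self)
    hence "0.585 * (1 + (cos (2 * t) - 0.17) / 1.17) \<le> 0.585 * E t"
      by (rule mult_left_mono) simp
    also have "0.585 * (1 + (cos (2 * t) - 0.17) / 1.17) = (cos t)\<^sup>2"
      by (simp only: cos_double_cos) (simp add: field_simps)
    finally show ?thesis .
  qed
  have "(cos_prod M x)\<^sup>2 = (\<Prod>k<M. (cos ((3 * real k + 1) * x))\<^sup>2 * (cos ((3 * real k + 2) * x))\<^sup>2)"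
    by (simp add: cos_prod_def power_mult_distrib prod_power_distrib)
  also have "\<dots> \<le> (\<Prod>k<M. (0.585 * E ((3 * real k + 1) * x)) * (0.585 * E ((3 * real k + 2) * x)))"
  proof (rule prod_mono)
    fix k
    have "(cos ((3 * real k + 1) * x))\<^sup>2 * (cos ((3 * real k + 2) * x))\<^sup>2
      \<le> (0.585 * E ((3 * real k + 1) * x)) * (0.585 * E ((3 * real k + 2) * x))"
      by (rule mult_mono[OF E E]) (simp_all add: E_def)
    thus "0 \<le> (cos ((3 * real k + 1) * x))\<^sup>2 * (cos ((3 * real k + 2) * x))\<^sup>2 \<and>
      (cos ((3 * real k + 1) * x))\<^sup>2 * (cos ((3 * real k + 2) * x))\<^sup>2
      \<le> (0.585 * E ((3 * real k + 1) * x)) * (0.585 * E ((3 * real k + 2) * x))" by simp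
  qed
  also have "\<dots> = 0.342225 ^ M * exp (\<Sum>k<M. ((cos (2 * ((3 * real k + 1) * x)) - 0.17) / 1.17)
      + ((cos (2 * ((3 * real k + 2) * x)) - 0.17) / 1.17))"
    by (induction M) (simp_all add: E_def exp_add)
  also have "(\<Sum>k<M. ((cos (2 * ((3 * real k + 1) * x)) - 0.17) / 1.17)
      + ((cos (2 * ((3 * real k + 2) * x)) - 0.17) / 1.17)) = (cos_sum M x - 0.34 * real M) / 1.17"
    unfolding cos_sum_def by (induction M) (simp_all add: field_simps)
  also have "(0.342225 :: real) ^ M * exp ((cos_sum M x - 0.34 * real M) / 1.17) \<le> 0.342225 ^ M * 1"
    using assms by (intro mult_left_mono) auto
  finally show ?thesis by simp
qed

lemma sin_ge_on:
  fixes a u :: real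
  assumes "0 \<le> a" "a \<le> u" "u \<le> pi - a"
  shows "sin a \<le> sin u"
proof (cases "u \<le> pi / 2")
  case True
  thus ?thesis using assms by (intro sin_monotone_2pi_le) auto
next
  case False
  hence "sin a \<le> sin (pi - u)" using assms by (intro sin_monotone_2pi_le) auto
  thus ?thesis by simp
qed

text \<open>The sum is cos x sin(6Mx) / sin(3x). Close to the zeros 0 and pi/3 of the denominator it
  is nonpositive. Elsewhere, with h = pi/M, either |sin(3x)| is at least about h, or it is at least
  about h/2 and cos x <= 0.53; both keep the quotient below 0.34 M.\<close>

lemma cos_sum_le:
  assumes M: "M \<ge> 40" and x: "pi / (6 * real M) \<le> x" "x \<le> pi / 2"
  shows "cos_sum M x \<le> 0.34 * real M"
proof -
  define h where "h = pi / real M"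
  have M': "real M \<ge> 40" using M by simp
  have pi: "3.14159 \<le> pi" "pi \<le> 3.1416" using pi_approx by auto
  have h0: "0 < h" using M' by (simp add: h_def)
  have h: "h \<le> 0.07854" using M' pi by (simp add: h_def field_simps)
  have Mh: "real M * h = pi" using M' by (simp add: h_def)
  have x1: "h / 6 \<le> x" using x by (simp add: h_def)
  have cx: "0 \<le> cos x" using x1 x h0 by (intro cos_ge_zero) auto
  have sin_scaled: "c * (1 - h\<^sup>2 / 6) * h \<le> sin (c * h)" if "0 \<le> c" "c \<le> 1" for c
  proof -
    have "c * (1 - h\<^sup>2 / 6) * h \<le> c * h - (c * h) ^ 3 / 6"
    proof -
      have "c ^ 3 * h ^ 3 \<le> c * h ^ 3"
        using that h0 power_decreasing[of 1 3 c] by (intro mult_right_mono) auto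
      thus ?thesis by (simp add: algebra_simps power2_eq_square power3_eq_cube)
    qed
    also have "\<dots> \<le> sin (c * h)" using that h0 by (intro sin_ge_cubic) auto
    finally show ?thesis .
  qed
  have h2: "h\<^sup>2 \<le> 0.00617" using power_mono[OF h, of 2] h0 by (simp add: power2_eq_square)
  have s1: "0.99897 * h \<le> sin h"
    by (rule order_trans[OF mult_right_mono sin_scaled[of 1, simplified]]) (use h2 h0 in auto)
  have s2: "0.499485 * h \<le> sin (h / 2)"
  proof -
    have "0.499485 * h \<le> 1 / 2 * (1 - h\<^sup>2 / 6) * h"
      using h2 h0 by (intro mult_right_mono) auto
    also have "\<dots> \<le> sin (1 / 2 * h)" by (rule sin_scaled) auto
    finally show ?thesis by simp
  qed
  have C: "sin (3 * x) * cos_sum M x = cos x * sin (6 * real M * x)"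
    by (rule sin_times_cos_sum)
  have nonpos: ?thesis if "a * cos_sum M x \<le> 0" "0 < a" for a
  proof -
    have "cos_sum M x \<le> 0" using that by (simp add: mult_le_0_iff)
    thus ?thesis using M' by simp
  qed
  \<comment> \<open>For a positive sum this rests on 0.53 / (0.49948 * 3.14159) < 0.34.\<close>
  have quot: ?thesis if "a * cos_sum M x \<le> b" "0.49948 * h \<le> a" "b \<le> 0.53" for a b
  proof (cases "cos_sum M x > 0")
    case True
    have "0.49948 * h * cos_sum M x \<le> a * cos_sum M x"
      using mult_right_mono[OF that(2), of "cos_sum M x"] True by simp
    also have "\<dots> \<le> 0.53" using that(1,3) by (rule order_trans)
    finally have "(0.49948 * h * cos_sum M x) * real M \<le> 0.53 * real M"
      by (rule mult_right_mono) simp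
    also have "(0.49948 * h * cos_sum M x) * real M = 0.49948 * cos_sum M x * pi"
      by (simp add: Mh[symmetric])
    finally have "0.49948 * cos_sum M x * pi \<le> 0.53 * real M" .
    moreover have "0.49948 * cos_sum M x * 3.14159 \<le> 0.49948 * cos_sum M x * pi"
      by (rule mult_left_mono[OF pi(1)]) (use True in simp)
    ultimately show ?thesis using M' by simp
  next
    case False
    thus ?thesis using M' by simp
  qed
  \<comment> \<open>The variable is centred at x = pi/3, the zero of sin(3x) inside the
    interval.\<close>
  define w where "w = 3 * x - pi"
  have sw: "sin (3 * x) = - sin w" by (simp add: w_def sin_diff)
  have "6 * real M * x = 2 * real M * w + 2 * real M * pi"
    by (simp add: w_def algebra_simps)
  hence "sin (6 * real M * x) = sin (2 * real M * w)"
    by (simp add: sin_add)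
  with C sw have Cw: "sin w * cos_sum M x = - cos x * sin (2 * real M * w)"
    "sin (- w) * cos_sum M x = cos x * sin (2 * real M * w)" by simp_all
  have wle: "w \<le> pi / 2" using x by (simp add: w_def)
  \<comment> \<open>From pi/3 - h/3 onwards, cos x exceeds 1/2 by at most h/3, which is less than
    0.03.\<close>
  have cos_le: "cos x \<le> 0.53" if "- h \<le> w"
  proof -
    have "cos x \<le> cos (pi / 3 - h / 3)"
      using that x h pi by (intro cos_monotone_0_pi_le) (auto simp: w_def)
    also have "\<dots> = cos (h / 3) / 2 + sqrt 3 / 2 * sin (h / 3)"
      by (simp add: cos_diff cos_60 sin_60)
    also have "\<dots> \<le> 1 / 2 + 1 * (h / 3)"
    proof (intro add_mono mult_mono)
      show "sqrt 3 / 2 \<le> 1" using real_sqrt_le_mono[of 3 4] by simp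
      show "sin (h / 3) \<le> h / 3" using h0 by (intro sin_x_le_x) auto
      show "0 \<le> sin (h / 3)" using h0 h pi by (intro sin_ge_zero) auto
    qed auto
    finally show ?thesis using h by simp
  qed
  have cb: "cos x * t \<le> cos x" "- cos x * t \<le> cos x" if "\<bar>t\<bar> \<le> 1" for t
    using mult_left_mono[of t 1 "cos x"] mult_left_mono[of "- t" 1 "cos x"] cx that by auto
  have Mt: "2 * real M * t \<le> pi" if "t \<le> h / 2" for t
    using mult_left_mono[OF that, of "2 * real M"] Mh by simp
  consider "x < h / 3" | "h / 3 \<le> x" "w \<le> - h" | "- h \<le> w" "w \<le> - h / 2"
    | "- h / 2 \<le> w" "w < 0" | "w = 0" | "0 < w" "w \<le> h / 2" | "h / 2 \<le> w"
    by linarith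
  thus ?thesis
  proof cases
    case 1
    have "pi \<le> 6 * real M * x"
      using mult_left_mono[OF x1, of "6 * real M"] Mh by simp
    moreover have "6 * real M * x < 2 * pi"
    proof -
      have "6 * real M * x < 6 * real M * (h / 3)"
        using 1 M' by (intro mult_strict_left_mono) auto
      also have "\<dots> = 2 * (real M * h)" by simp
      finally show ?thesis using Mh by simp
    qed
    ultimately have "sin (6 * real M * x) \<le> 0" by (rule sin_le_zero)
    hence "sin (3 * x) * cos_sum M x \<le> 0"
      unfolding C using cx by (simp add: mult_nonneg_nonpos)
    moreover have "0 < sin (3 * x)"
      using 1 x1 h0 h pi by (intro sin_gt_zero) auto
    ultimately show ?thesis by (rule nonpos)
  next
    case 2
    have "sin h \<le> sin (3 * x)" using 2 h0 by (intro sin_ge_on) (auto simp: w_def)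
    \<comment> \<open>Only cos x <= 1 is available here, but sin(3x) is at least sin h; halving
      brings both into the form that \<open>quot\<close> needs.\<close>
    hence "0.49948 * h \<le> sin (3 * x) / 2" using s1 h0 by simp
    moreover have "sin (3 * x) / 2 * cos_sum M x \<le> 1 / 2"
      using C cb(1)[of "sin (6 * real M * x)"] by simp (smt (verit) cos_le_one)
    ultimately show ?thesis by (intro quot[of "sin (3 * x) / 2" "1/2"]) auto
  next
    case 3
    have "sin (h / 2) \<le> sin (- w)" using 3 h0 h pi by (intro sin_ge_on) auto
    thus ?thesis
      using s2 h0 Cw(2) cb(1)[of "sin (2 * real M * w)"] cos_le 3
      by (intro quot[of "sin (- w)" "cos x"]) auto
  next
    case 4
    have "0 \<le> sin (2 * real M * (- w))" using 4 by (intro sin_ge_zero Mt) (auto simp: mult_nonneg_nonpos)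
    hence "sin (- w) * cos_sum M x \<le> 0"
      unfolding Cw(2) using cx by (simp add: mult_nonneg_nonpos)
    moreover have "0 < sin (- w)" using 4 h pi by (intro sin_gt_zero) auto
    ultimately show ?thesis by (rule nonpos)
  next
    case 5
    \<comment> \<open>Here sin(3x) = 0 and the closed form says nothing, but every cosine in the sum
      equals -1/2.\<close>
    hence x: "x = pi / 3" by (simp add: w_def)
    have "cos (2 * ((3 * real k + 1) * x)) = - 1 / 2" for k
    proof -
      have "2 * ((3 * real k + 1) * x) = 2 * real k * pi + 2 * pi / 3" by (simp add: x algebra_simps)
      thus ?thesis by (simp add: cos_add cos_120)
    qed
    moreover have "cos (2 * ((3 * real k + 2) * x)) = - 1 / 2" for k
    proof -
      have "2 * ((3 * real k + 2) * x) = 2 * real (Suc k) * pi - 2 * pi / 3" by (simp add: x algebra_simps)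
      thus ?thesis by (simp only: cos_diff cos_2npi sin_2npi) (simp add: cos_120)
    qed
    ultimately show ?thesis using M' by (simp add: cos_sum_def)
  next
    case 6
    have "0 \<le> sin (2 * real M * w)" using 6 by (intro sin_ge_zero Mt) auto
    hence "sin w * cos_sum M x \<le> 0"
      unfolding Cw(1) using cx by simp
    moreover have "0 < sin w" using 6 h pi by (intro sin_gt_zero) auto
    ultimately show ?thesis by (rule nonpos)
  next
    case 7
    have "sin (h / 2) \<le> sin w" using 7 h0 h pi wle by (intro sin_ge_on) auto
    thus ?thesis
      using s2 h0 Cw(1) cb(2)[of "sin (2 * real M * w)"] cos_le 7
      by (intro quot[of "sin w" "cos x"]) auto
  qed
qed


section \<open>Nonnegativity of the integral in the window\<close>

lemma power_decay:
  assumes "M \<ge> 40"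
  shows "real M ^ 9 * 0.342225 ^ M \<le> 1 / 10000"
  using assms
proof (induction M rule: dec_induct)
  case base
  show ?case by (simp add: power_divide)
next
  case (step M)
  \<comment> \<open>(M + 1)/M is at most 41/40 = 1.025, whose ninth power is below 2, and 2 *
    0.342225 < 1.\<close>
  have "real (Suc M) ^ 9 \<le> (1.025 * real M) ^ 9"
    using step.hyps by (intro power_mono) auto
  also have "\<dots> = 1.025 ^ 9 * real M ^ 9" by (rule power_mult_distrib)
  also have "\<dots> \<le> 2 * real M ^ 9" by (intro mult_right_mono) (simp_all add: power_divide)
  finally have "real (Suc M) ^ 9 * 0.342225 ^ Suc M \<le> 2 * real M ^ 9 * 0.342225 ^ Suc M"
    by (rule mult_right_mono) simp
  also have "\<dots> = 0.68445 * (real M ^ 9 * 0.342225 ^ M)" by simp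
  also have "\<dots> \<le> 1 * (1 / 10000)" by (intro mult_mono step.IH) simp_all
  finally show ?case by simp
qed

lemma integral_cubic_quintic:
  assumes "0 \<le> (b :: real)"
  shows "((\<lambda>x. c * (x\<^sup>2 * (1 - a * x\<^sup>2))) has_integral c * (b ^ 3 / 3 - a * b ^ 5 / 5)) {0..b}"
proof -
  have "((\<lambda>x. c * (x\<^sup>2 * (1 - a * x\<^sup>2))) has_integral
      (c * (b ^ 3 / 3 - a * b ^ 5 / 5)) - (c * (0 ^ 3 / 3 - a * 0 ^ 5 / 5))) {0..b}"
    by (intro fundamental_theorem_of_calculus assms)
       (auto intro!: derivative_eq_intros
         simp: has_real_derivative_iff_has_vector_derivative[symmetric] algebra_simps
           power2_eq_square eval_nat_numeral)
  thus ?thesis by simp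
qed

text \<open>The interval is cut at \<open>x0\<close> and \<open>x1\<close>. The gain on [0, x0] and
  the bound for the tail are both multiples of s, so s cancels in the comparison; in the tail the
  factor comes from |sin x sin(sx)| <= 1 <= s. The bound s <= 6M - 2 keeps sx at most pi up to
  \<open>x1\<close>.\<close>

lemma integral_cos_prod_nonneg:
  assumes M: "M \<ge> 40" and s: "s \<le> 6 * real M - 2" "s = 0 \<or> 1 \<le> s"
  shows "0 \<le> integral {0..pi / 2} (\<lambda>x. cos_prod M x * sin x * sin (s * x))"
proof (cases "s = 0")
  case True
  thus ?thesis by simp
next
  case False
  with s have s1: "1 \<le> s" by simp
  have M': "real M \<ge> 40" using M by simp
  have pi: "3.14159 \<le> pi" "pi \<le> 3.1416" using pi_approx by auto
  define g where "g x = cos_prod M x * sin x * sin (s * x)" for x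
  define x1 where "x1 = pi / (6 * real M)"
  \<comment> \<open>the zero of the lower bound \<open>1 - 3 M\<^sup>3 x\<^sup>2\<close> of the cosine product\<close>
  define x0 where "x0 = sqrt (1 / (3 * real M ^ 3))"
  have x0: "0 \<le> x0" "x0\<^sup>2 = 1 / (3 * real M ^ 3)" by (simp_all add: x0_def)
  have x1: "0 \<le> x1" "x1 \<le> pi / 2" using M' by (simp_all add: x1_def field_simps)
  have x01: "x0 \<le> x1"
  proof (rule power2_le_imp_le[OF _ x1(1)])
    have "12 \<le> pi\<^sup>2 * real M"
      using mult_mono[OF power_mono[OF pi(1), of 2] M'] by (simp add: power_divide)
    thus "x0\<^sup>2 \<le> x1\<^sup>2"
      unfolding x0 x1_def using M' by (simp add: field_simps eval_nat_numeral)
  qed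
  have cont: "continuous_on A g" for A
    unfolding g_def by (intro continuous_intros)
  have int: "g integrable_on {a..b}" for a b
    by (rule integrable_continuous_real[OF cont])
  have arg: "(6 * real M - 2) * x \<le> pi" if "0 \<le> x" "x \<le> x1" for x
  proof -
    have "(6 * real M - 2) * x \<le> 6 * real M * x1"
      using that M' by (intro mult_mono) auto
    also have "\<dots> = pi" using M' by (simp add: x1_def)
    finally show ?thesis .
  qed
  have nonneg: "0 \<le> g x" if "0 \<le> x" "x \<le> x1" for x
  proof -
    have "s * x \<le> (6 * real M - 2) * x" using s that by (intro mult_right_mono) auto
    hence "s * x \<le> pi" using arg[OF that] by simp
    thus ?thesis unfolding g_def
      using that x1 s1 pi by (intro mult_nonneg_nonneg cos_prod_nonneg arg sin_ge_zero) auto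
  qed
  \<comment> \<open>On [0, x0], sin x >= 0.99999 x and sin(sx) >= 0.95 sx; 0.9499 is just below the
    product of these constants.\<close>
  define c where "c = 0.9499 * s"
  have lower: "c * (x\<^sup>2 * (1 - 3 * real M ^ 3 * x\<^sup>2)) \<le> g x" if "0 \<le> x" "x \<le> x0" for x
  proof -
    have xx: "x\<^sup>2 \<le> 1 / (3 * real M ^ 3)"
      using power_mono[OF that(2) that(1), of 2] x0 by simp
    have M3: "64000 \<le> real M ^ 3" using power_mono[OF M', of 3] by simp
    have a: "3 * real M ^ 3 * x\<^sup>2 \<le> 1" using xx M' by (simp add: field_simps)
    have "1 - 3 * real M ^ 3 * x\<^sup>2 \<le> 1 - (6 * real M ^ 3 - real M) / 2 * x\<^sup>2"
      by (simp add: algebra_simps)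
    also have "\<dots> \<le> cos_prod M x" using that x01 by (intro cos_prod_ge arg) auto
    finally have f: "1 - 3 * real M ^ 3 * x\<^sup>2 \<le> cos_prod M x" .
    have "x\<^sup>2 \<le> 1 / (3 * 64000)"
      by (rule order_trans[OF xx]) (use M3 in \<open>simp add: divide_simps\<close>)
    hence "0.99999 \<le> 1 - x\<^sup>2 / 6" by simp
    hence "x * 0.99999 \<le> x * (1 - x\<^sup>2 / 6)" using that by (intro mult_left_mono) auto
    also have "\<dots> \<le> sin x" using sin_ge_cubic[OF that(1)] by (simp add: algebra_simps eval_nat_numeral)
    finally have sx: "x * 0.99999 \<le> sin x" .
    have "(s * x)\<^sup>2 \<le> (6 * real M)\<^sup>2 * x\<^sup>2"
      unfolding power_mult_distrib[of s x] using s s1 by (intro mult_right_mono power_mono) auto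
    also have "\<dots> \<le> (6 * real M)\<^sup>2 * (1 / (3 * real M ^ 3))" by (intro mult_left_mono xx) auto
    also have "\<dots> = 12 / real M" using M' by (simp add: field_simps eval_nat_numeral)
    also have "\<dots> \<le> 0.3" using M' by (simp add: field_simps)
    finally have "0.95 \<le> 1 - (s * x)\<^sup>2 / 6" by simp
    hence "(s * x) * 0.95 \<le> (s * x) * (1 - (s * x)\<^sup>2 / 6)" using that s1 by (intro mult_left_mono) auto
    also have "\<dots> \<le> sin (s * x)"
      using sin_ge_cubic[of "s * x"] that s1 by (simp add: algebra_simps eval_nat_numeral)
    finally have ssx: "(s * x) * 0.95 \<le> sin (s * x)" .
    have "c * (x\<^sup>2 * (1 - 3 * real M ^ 3 * x\<^sup>2))
        \<le> (0.99999 * 0.95 * s) * (x\<^sup>2 * (1 - 3 * real M ^ 3 * x\<^sup>2))"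
      unfolding c_def using s1 a by (intro mult_right_mono) auto
    also have "\<dots> = (1 - 3 * real M ^ 3 * x\<^sup>2) * (x * 0.99999) * ((s * x) * 0.95)"
      by (simp add: power2_eq_square)
    also have "\<dots> \<le> g x" unfolding g_def
      using f sx ssx a that s1 by (intro mult_mono mult_nonneg_nonneg) (auto intro: order_trans[OF _ sx] order_trans[OF _ f])
    finally show ?thesis .
  qed
  \<comment> \<open>Uses 3 M^3 x0^2 = 1 and 1/3 - 1/5 = 2/15.\<close>
  have "c * (x0 ^ 3 * (2 / 15)) = c * (x0 ^ 3 / 3 - 3 * real M ^ 3 * x0 ^ 5 / 5)"
  proof -
    have "x0 ^ 5 = x0 ^ 3 * x0\<^sup>2" by (simp add: eval_nat_numeral)
    thus ?thesis using M' by (simp add: x0(2) field_simps)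
  qed
  also have "\<dots> \<le> integral {0..x0} g"
    by (rule has_integral_le[OF integral_cubic_quintic[OF x0(1)] integrable_integral[OF int]])
       (use lower in auto)
  finally have main: "c * (x0 ^ 3 * (2 / 15)) \<le> integral {0..x0} g" .
  have mid: "0 \<le> integral {x0..x1} g"
    using x0 by (intro integral_nonneg int nonneg) auto
  have upper: "norm (g x) \<le> 0.585 ^ M * s" if "x1 \<le> x" "x \<le> pi / 2" for x
  proof -
    have "(cos_prod M x)\<^sup>2 \<le> 0.342225 ^ M"
      by (intro cos_prod_squared_le cos_sum_le M) (use that in \<open>simp_all add: x1_def\<close>)
    also have "(0.342225 :: real) ^ M = (0.585 ^ M)\<^sup>2"
      by (simp flip: power_mult_distrib add: power2_eq_square)
    finally have "\<bar>cos_prod M x\<bar> \<le> 0.585 ^ M"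
      by (simp add: abs_le_square_iff[symmetric])
    moreover have "\<bar>sin x * sin (s * x)\<bar> \<le> 1"
      unfolding abs_mult by (intro mult_le_one) auto
    ultimately have "\<bar>cos_prod M x\<bar> * \<bar>sin x * sin (s * x)\<bar> \<le> 0.585 ^ M * s"
      using s1 by (intro mult_mono) auto
    thus ?thesis by (simp add: g_def abs_mult mult_ac)
  qed
  have "norm (integral {x1..pi / 2} g) \<le> 0.585 ^ M * s * (pi / 2 - x1)"
    by (rule integral_bound[OF x1(2) cont]) (use upper in auto)
  also have "\<dots> \<le> 0.585 ^ M * s * 2"
    using x1 pi s1 by (intro mult_left_mono) auto
  finally have rest: "- (0.585 ^ M * s * 2) \<le> integral {x1..pi / 2} g" by simp
  \<comment> \<open>Squaring removes the root in \<open>x0\<close>: x0^6 = 1/(27 M^9), and 0.585^2 =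
    0.342225, which leads to the quantity in \<open>power_decay\<close>.\<close>
  have "2 * 0.585 ^ M \<le> 0.9499 * (x0 ^ 3 * (2 / 15))"
  proof (rule power2_le_imp_le)
    have "(2 * 0.585 ^ M)\<^sup>2 = 4 * (0.342225 :: real) ^ M"
      by (simp add: power_mult_distrib flip: power_mult)
         (simp add: mult.commute[of M] power_mult power2_eq_square)
    also have "\<dots> \<le> 4 * (1 / (10000 * real M ^ 9))"
      using power_decay[OF M] M' by (simp add: field_simps)
    also have "\<dots> \<le> (0.9499 * 2 / 15)\<^sup>2 * (1 / (27 * real M ^ 9))"
      using M' by (simp add: field_simps power2_eq_square)
    also have "1 / (27 * real M ^ 9) = (x0\<^sup>2) ^ 3"
      by (simp add: x0 power_divide power_mult_distrib flip: power_mult)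
    also have "(0.9499 * 2 / 15)\<^sup>2 * (x0\<^sup>2) ^ 3 = (0.9499 * (x0 ^ 3 * (2 / 15)))\<^sup>2"
      by (simp add: power_mult_distrib power_divide flip: power_mult)
    finally show "(2 * 0.585 ^ M)\<^sup>2 \<le> (0.9499 * (x0 ^ 3 * (2 / 15)))\<^sup>2" .
    show "0 \<le> 0.9499 * (x0 ^ 3 * (2 / 15))" using x0 by simp
  qed
  from mult_left_mono[OF this, of s]
  have "0.585 ^ M * s * 2 \<le> c * (x0 ^ 3 * (2 / 15))"
    using s1 by (simp add: c_def mult_ac)
  moreover have "integral {0..x0} g + integral {x0..x1} g + integral {x1..pi / 2} g = integral {0..pi / 2} g"
    using Henstock_Kurzweil_Integration.integral_combine[OF x0(1) x01 int]
      Henstock_Kurzweil_Integration.integral_combine[OF order_trans[OF x0(1) x01] x1(2) int]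
    by simp
  ultimately have "0 \<le> integral {0..pi / 2} g" using main mid rest by linarith
  thus ?thesis by (simp add: g_def[abs_def])
qed

section \<open>The product and its coefficients\<close>

definition mprod :: "nat \<Rightarrow> int poly" where
  "mprod M = (\<Prod>k<M. (1 + monom 1 (3 * k + 1)) * (1 + monom 1 (3 * k + 2)))"

definition mdiff :: "nat \<Rightarrow> int poly" where
  "mdiff M = (1 - monom 1 1) * mprod M"

lemma coeff_one_plus_monom_mult:
  "coeff ((1 + monom 1 a) * p) i = coeff p i + (if a \<le> i then coeff p (i - a) else (0 :: int))"
  by (simp add: distrib_right coeff_monom_mult)

lemma coeff_mdiff_Suc: "coeff (mdiff M) (Suc i) = coeff (mprod M) (Suc i) - coeff (mprod M) i"
  by (simp add: mdiff_def left_diff_distrib coeff_monom_mult)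

lemma mdiff_Suc: "mdiff (Suc M) = (1 + monom 1 (3 * M + 2)) * ((1 + monom 1 (3 * M + 1)) * mdiff M)"
  by (simp add: mdiff_def mprod_def mult_ac)

lemma mprod_neq_0: "mprod M \<noteq> 0"
proof -
  have "coeff (1 + monom 1 (Suc k)) 0 \<noteq> (0 :: int)" for k by simp
  hence "1 + monom 1 (Suc k) \<noteq> (0 :: int poly)" for k by (metis coeff_0)
  thus ?thesis by (simp add: mprod_def)
qed

lemma degree_mprod: "degree (mprod M) = 3 * M\<^sup>2"
proof -
  have deg: "degree (1 + monom 1 (Suc k) :: int poly) = Suc k" for k
    by (subst degree_add_eq_right) (simp_all add: degree_monom_eq)
  have nz: "1 + monom 1 (Suc k) \<noteq> (0 :: int poly)" for k
    using deg[of k] by auto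
  show ?thesis
  proof (induction M)
    case 0
    thus ?case by (simp add: mprod_def)
  next
    case (Suc M)
    have "mprod (Suc M) = mprod M * ((1 + monom 1 (Suc (3 * M))) * (1 + monom 1 (Suc (3 * M + 1))))"
      by (simp add: mprod_def)
    also have "degree \<dots> = 3 * M\<^sup>2 + (Suc (3 * M) + Suc (3 * M + 1))"
      using mprod_neq_0[of M] nz[of "3 * M"] nz[of "3 * M + 1"]
      by (simp add: degree_mult_eq Suc.IH deg del: One_nat_def)
    finally show ?case by (simp add: power2_eq_square)
  qed
qed

text \<open>Each factor 1 + q^k is its own reversal, and reversal is multiplicative.\<close>

lemma reflect_mprod: "reflect_poly (mprod M) = mprod M"
proof -
  have "reflect_poly (1 + monom 1 (Suc k)) = (1 + monom 1 (Suc k) :: int poly)" for k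
  proof -
    have "degree (1 + monom 1 (Suc k) :: int poly) = Suc k"
      by (subst degree_add_eq_right) (simp_all add: degree_monom_eq)
    thus ?thesis
      by (intro poly_eqI) (auto simp: coeff_reflect_poly coeff_monom coeff_1)
  qed
  from this[of "3 * _"] this[of "3 * _ + 1"] show ?thesis
    by (simp add: mprod_def reflect_poly_prod reflect_poly_mult)
qed

lemma coeff_mprod_sym: "i \<le> 3 * M\<^sup>2 \<Longrightarrow> coeff (mprod M) (3 * M\<^sup>2 - i) = coeff (mprod M) i"
  using reflect_mprod[of M] coeff_reflect_poly[of "mprod M" i]
  by (simp add: degree_mprod)

text \<open>\<open>mdiff M\<close> has degree 3M^2 + 1 and antisymmetric coefficients, the
  successive differences of those of \<open>mprod M\<close>; so its lower half decides
  unimodality.\<close>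

definition half_nonneg :: "nat \<Rightarrow> bool" where
  "half_nonneg M \<longleftrightarrow> (\<forall>i. 2 * i \<le> 3 * M\<^sup>2 + 1 \<longrightarrow> 0 \<le> coeff (mdiff M) i)"

section \<open>Coefficients as integrals\<close>

definition ceval :: "int poly \<Rightarrow> complex \<Rightarrow> complex" where
  "ceval p z = poly (map_poly of_int p) z"

lemma ceval_mult: "ceval (p * q) z = ceval p z * ceval q z"
proof -
  have "map_poly of_int (p * q) = map_poly of_int p * (map_poly of_int q :: complex poly)"
    by (intro poly_eqI) (simp add: coeff_map_poly coeff_mult)
  thus ?thesis by (simp add: ceval_def)
qed

lemma ceval_one_plus_monom: "ceval (1 + monom 1 a) z = 1 + z ^ a"
proof -
  have "map_poly of_int (1 + monom 1 a) = (1 + monom 1 a :: complex poly)"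
    by (intro poly_eqI) (simp add: coeff_map_poly coeff_1)
  thus ?thesis by (simp add: ceval_def poly_monom)
qed

lemma ceval_one_minus_monom: "ceval (1 - monom 1 a) z = 1 - z ^ a"
proof -
  have "map_poly of_int (1 - monom 1 a) = (1 - monom 1 a :: complex poly)"
    by (intro poly_eqI) (simp add: coeff_map_poly coeff_1)
  thus ?thesis by (simp add: ceval_def poly_monom)
qed

lemma ceval_altdef: "ceval p z = (\<Sum>m\<le>degree p. of_int (coeff p m) * z ^ m)"
  by (simp add: ceval_def poly_altdef coeff_map_poly degree_map_poly)

lemma one_plus_cis: "1 + cis (2 * t) = of_real (2 * cos t) * cis t"
  by (simp add: complex_eq_iff cos_double_cos sin_double power2_eq_square)

lemma one_minus_cis: "1 - cis (2 * t) = - 2 * \<i> * of_real (sin t) * cis t"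
  by (simp add: complex_eq_iff cos_double_sin sin_double power2_eq_square)

text \<open>At q = e^(2ix) the factor 1 + q^j is 2 cos(jx) times a phase of angle jx, and the
  exponents j add up to 3M^2.\<close>

lemma ceval_mprod: "ceval (mprod M) (cis (2 * x)) = of_real (4 ^ M * cos_prod M x) * cis (3 * real M ^ 2 * x)"
proof (induction M)
  case 0
  have "ceval 1 z = 1" for z by (simp add: ceval_def)
  thus ?case by (simp add: mprod_def cos_prod_def)
next
  case (Suc M)
  have pow: "cis (2 * x) ^ k = cis (2 * (real k * x))" for k
    by (simp add: Complex.DeMoivre mult_ac)
  have "mprod (Suc M) = mprod M * ((1 + monom 1 (3 * M + 1)) * (1 + monom 1 (3 * M + 2)))"
    by (simp add: mprod_def)
  hence "ceval (mprod (Suc M)) (cis (2 * x)) = ceval (mprod M) (cis (2 * x)) *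
      ((1 + cis (2 * ((3 * real M + 1) * x))) * (1 + cis (2 * ((3 * real M + 2) * x))))"
    by (simp only: ceval_mult ceval_one_plus_monom pow) (simp add: add.commute)
  also have "\<dots> = of_real (4 ^ Suc M * cos_prod (Suc M) x) *
     (cis (3 * real M ^ 2 * x) * cis ((3 * real M + 1) * x) * cis ((3 * real M + 2) * x))"
    by (simp only: Suc.IH one_plus_cis) (simp add: cos_prod_def)
  also have "cis (3 * real M ^ 2 * x) * cis ((3 * real M + 1) * x) * cis ((3 * real M + 2) * x)
     = cis (3 * real (Suc M) ^ 2 * x)"
    by (simp add: cis_mult power2_eq_square algebra_simps)
  finally show ?case .
qed

text \<open>Multiply by q^(-i) and take real parts. The factor 1 - q supplies sin x and an imaginary
  unit, which turns the real part of the remaining phase into a sine.\<close>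

lemma cos_sum_mdiff:
  "(\<Sum>m\<le>degree (mdiff M). of_int (coeff (mdiff M) m) * cos (2 * (real m - real i) * x))
    = 2 * 4 ^ M * (cos_prod M x * sin x * sin ((3 * real M ^ 2 + 1 - 2 * real i) * x))"
proof -
  have pow: "cis (2 * x) ^ k = cis (2 * (real k * x))" for k
    by (simp add: Complex.DeMoivre mult_ac)
  have "(\<Sum>m\<le>degree (mdiff M). of_int (coeff (mdiff M) m) * cos (2 * (real m - real i) * x))
    = Re (ceval (mdiff M) (cis (2 * x)) * cis (- (2 * real i * x)))"
  proof -
    have "ceval (mdiff M) (cis (2 * x)) * cis (- (2 * real i * x))
      = (\<Sum>m\<le>degree (mdiff M). of_int (coeff (mdiff M) m) * cis (2 * (real m - real i) * x))"
      unfolding ceval_altdef sum_distrib_right pow mult.assoc cis_mult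
      by (simp add: algebra_simps)
    thus ?thesis by simp
  qed
  also have "ceval (mdiff M) (cis (2 * x)) * cis (- (2 * real i * x))
    = of_real (2 * 4 ^ M * (cos_prod M x * sin x)) * (- \<i>) *
      (cis x * cis (3 * real M ^ 2 * x) * cis (- (2 * real i * x)))"
    unfolding mdiff_def ceval_mult ceval_one_minus_monom ceval_mprod power_one_right one_minus_cis
    by simp
  also have "cis x * cis (3 * real M ^ 2 * x) * cis (- (2 * real i * x))
    = cis ((3 * real M ^ 2 + 1 - 2 * real i) * x)"
    by (simp add: cis_mult algebra_simps)
  also have "Re (of_real (2 * 4 ^ M * (cos_prod M x * sin x)) * (- \<i>) * cis ((3 * real M ^ 2 + 1 - 2 * real i) * x))
    = 2 * 4 ^ M * (cos_prod M x * sin x * sin ((3 * real M ^ 2 + 1 - 2 * real i) * x))"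
    by simp
  finally show ?thesis .
qed

text \<open>For m different from i the frequency is a nonzero even integer, so the antiderivative
  vanishes at 0 and at pi/2.\<close>

lemma has_integral_cos_even:
  "((\<lambda>x. cos (2 * (real m - real i) * x)) has_integral (if m = i then pi / 2 else 0)) {0..pi / 2}"
proof (cases "m = i")
  case True
  thus ?thesis using has_integral_const_real[of "1 :: real" 0 "pi / 2"] by simp
next
  case False
  define k where "k = 2 * (real m - real i)"
  have k: "k \<noteq> 0" using False by (simp add: k_def)
  have "((\<lambda>x. cos (k * x)) has_integral sin (k * (pi / 2)) / k - sin (k * 0) / k) {0..pi / 2}"
    by (intro fundamental_theorem_of_calculus)
       (use k in \<open>auto intro!: derivative_eq_intros
         simp: has_real_derivative_iff_has_vector_derivative[symmetric]\<close>)
  moreover have "k * (pi / 2) = of_int (int m - int i) * pi" by (simp add: k_def)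
  hence "sin (k * (pi / 2)) = 0" unfolding sin_zero_iff_int2 by blast
  ultimately show ?thesis using False by (simp add: k_def)
qed

lemma coeff_mdiff_integral:
  "of_int (coeff (mdiff M) i) * (pi / 2) = 2 * 4 ^ M *
     integral {0..pi / 2} (\<lambda>x. cos_prod M x * sin x * sin ((3 * real M ^ 2 + 1 - 2 * real i) * x))"
proof -
  have "((\<lambda>x. \<Sum>m\<le>degree (mdiff M). of_int (coeff (mdiff M) m) * cos (2 * (real m - real i) * x)) has_integral
     (\<Sum>m\<le>degree (mdiff M). of_int (coeff (mdiff M) m) * (if m = i then pi / 2 else 0))) {0..pi / 2}"
    by (intro has_integral_sum has_integral_mult_right has_integral_cos_even) simp
  \<comment> \<open>If i exceeds the degree, no term survives and the coefficient is 0 as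
    well.\<close>
  also have "(\<Sum>m\<le>degree (mdiff M). of_int (coeff (mdiff M) m) * (if m = i then pi / 2 else 0))
    = of_int (coeff (mdiff M) i) * (pi / 2)"
    by (simp add: if_distrib sum.delta coeff_eq_0 cong: if_cong)
  finally have "integral {0..pi / 2} (\<lambda>x. 2 * 4 ^ M *
      (cos_prod M x * sin x * sin ((3 * real M ^ 2 + 1 - 2 * real i) * x)))
    = of_int (coeff (mdiff M) i) * (pi / 2)"
    unfolding cos_sum_mdiff by (rule integral_unique)
  thus ?thesis by simp
qed

section \<open>Computation of the small cases\<close>

text \<open>
  The coefficient of \<open>q\<^bsup>48t + r\<^esup>\<close> with \<open>t, r < 48\<close> is stored in row \<open>r\<close>, column \<open>t\<close>; this covers all
  indices up to the middle for \<open>M \<le> 39\<close>. Multiplication by \<open>q\<^sup>a\<close> then rotates the rows by \<open>a mod 48\<close> and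
  prepends \<open>a div 48\<close> zeros, one more in the rows that wrap around; a pair \<open>(z, us)\<close> holds these zeros
  and, in unary, \<open>48 - a mod 48\<close>. Short rows keep the rewriting steps of the evaluation cheap.
\<close>

fun row_add :: "int list \<Rightarrow> int list \<Rightarrow> int list" where
  "row_add (x # xs) (y # ys) = (x + y) # row_add xs ys"
| "row_add xs [] = xs"
| "row_add [] ys = []"

fun rows_add :: "int list list \<Rightarrow> int list list \<Rightarrow> int list list" where
  "rows_add (x # xs) (y # ys) = row_add x y # rows_add xs ys"
| "rows_add xs [] = xs"
| "rows_add [] ys = []"

fun utake :: "unit list \<Rightarrow> 'a list \<Rightarrow> 'a list" where
  "utake (u # us) (x # xs) = x # utake us xs"
| "utake us [] = []"
| "utake [] xs = []"

fun udrop :: "unit list \<Rightarrow> 'a list \<Rightarrow> 'a list" where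
  "udrop (u # us) (x # xs) = udrop us xs"
| "udrop us [] = []"
| "udrop [] xs = xs"

fun rows_prepend :: "int list \<Rightarrow> int list list \<Rightarrow> int list list" where
  "rows_prepend z (x # xs) = (z @ x) # rows_prepend z xs"
| "rows_prepend z [] = []"

fun rows_shift :: "int list \<times> unit list \<Rightarrow> int list list \<Rightarrow> int list list" where
  "rows_shift (z, us) l = rows_prepend (0 # z) (udrop us l) @ rows_prepend z (utake us l)"

fun rows_mult :: "int list \<times> unit list \<Rightarrow> int list list \<Rightarrow> int list list" where
  "rows_mult c l = rows_add l (rows_shift c l)"

text \<open>Passes from q^a to q^(a+1). When one unit is left, a + 1 is a multiple of 48: the
  counter is refilled and one more zero is prepended. An empty counter represents no shift.\<close>

fun shift_Suc :: "int list \<times> unit list \<Rightarrow> int list \<times> unit list" where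
  "shift_Suc (z, u # v # us) = (z, v # us)"
| "shift_Suc (z, [u]) = (0 # z, replicate 48 ())"
| "shift_Suc (z, []) = (z, [])"

text \<open>Positions are doubled, so that \<open>h = 3m\<^sup>2 + 1\<close> needs no division.\<close>

fun row_check :: "int \<Rightarrow> int \<Rightarrow> int list \<Rightarrow> bool" where
  "row_check h i (x # xs) \<longleftrightarrow> h < i \<or> 0 \<le> x \<and> row_check h (i + 96) xs"
| "row_check h i [] \<longleftrightarrow> True"

fun rows_check :: "int \<Rightarrow> int \<Rightarrow> int list list \<Rightarrow> bool" where
  "rows_check h i (x # xs) \<longleftrightarrow> row_check h i x \<and> rows_check h (i + 2) xs"
| "rows_check h i [] \<longleftrightarrow> True"

text \<open>The unit list counts the remaining steps; \<open>c\<close> encodes multiplication by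
  q^(3m+1), and three increments lead to the next m.\<close>

fun run_check :: "unit list \<Rightarrow> int \<Rightarrow> int list \<times> unit list \<Rightarrow> int list list \<Rightarrow> bool" where
  "run_check (u # us) m c l \<longleftrightarrow> rows_check (3 * m * m + 1) 0 l \<and>
     run_check us (m + 1) (shift_Suc (shift_Suc (shift_Suc c))) (rows_mult (shift_Suc c) (rows_mult c l))"
| "run_check [] m c l \<longleftrightarrow> rows_check (3 * m * m + 1) 0 l"

section \<open>Correctness of the row representation\<close>

definition rows_of :: "int poly \<Rightarrow> int list list \<Rightarrow> bool" where
  "rows_of p l \<longleftrightarrow> length l = 48 \<and>
     (\<forall>r<48. length (l ! r) = 48 \<and> (\<forall>t<48. l ! r ! t = coeff p (48 * t + r)))"

definition shift_of :: "nat \<Rightarrow> int list \<times> unit list \<Rightarrow> bool" where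
  "shift_of a c \<longleftrightarrow> c = (replicate (a div 48) 0, replicate (48 - a mod 48) ())"

text \<open>The left argument fixes the length, so whatever a shift pushes past column 47 is
  dropped. Multiplication by 1 + q^a carries coefficients only upwards, so nothing below 48 * 48 is
  lost.\<close>

lemma length_row_add [simp]: "length (row_add xs ys) = length xs"
  by (induction xs ys rule: row_add.induct) auto

lemma nth_row_add:
  "t < length xs \<Longrightarrow> t < length ys \<Longrightarrow> row_add xs ys ! t = xs ! t + ys ! t"
  by (induction xs ys arbitrary: t rule: row_add.induct) (auto simp: nth_Cons split: nat.splits)

lemma length_rows_add [simp]: "length (rows_add xs ys) = length xs"
  by (induction xs ys rule: rows_add.induct) auto

lemma nth_rows_add:
  "t < length xs \<Longrightarrow> t < length ys \<Longrightarrow> rows_add xs ys ! t = row_add (xs ! t) (ys ! t)"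
  by (induction xs ys arbitrary: t rule: rows_add.induct) (auto simp: nth_Cons split: nat.splits)

lemma utake_eq: "utake us xs = take (length us) xs"
  by (induction us xs rule: utake.induct) auto

lemma udrop_eq: "udrop us xs = drop (length us) xs"
  by (induction us xs rule: udrop.induct) auto

lemma rows_prepend_eq: "rows_prepend z l = map ((@) z) l"
  by (induction l) auto

lemma shift_of_Suc:
  assumes "shift_of a c"
  shows "shift_of (Suc a) (shift_Suc c)"
proof -
  have mod: "a mod 48 < 48" by simp
  define n where "n = 47 - a mod 48"
  have "48 - a mod 48 = Suc n" using mod by (simp add: n_def)
  hence c: "c = (replicate (a div 48) 0, () # replicate n ())"
    using assms unfolding shift_of_def by (simp only: replicate_Suc)
  show ?thesis
  proof (cases n)
    case 0
    hence "a mod 48 = 47" using mod by (simp add: n_def)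
    hence "Suc a mod 48 = 0" "Suc a div 48 = Suc (a div 48)" by (simp_all add: mod_Suc div_Suc)
    thus ?thesis
      by (simp only: c 0 shift_of_def replicate.simps shift_Suc.simps diff_zero)
  next
    case (Suc k)
    hence "a mod 48 < 47" by (simp add: n_def)
    hence "Suc a mod 48 = Suc (a mod 48)" "Suc a div 48 = a div 48" by (simp_all add: mod_Suc div_Suc)
    moreover from this have "48 - Suc a mod 48 = Suc k" using Suc by (simp add: n_def)
    ultimately show ?thesis
      by (simp only: c Suc shift_of_def replicate.simps shift_Suc.simps)
  qed
qed

text \<open>With a = 48u + v, row r of the shifted table is old row r - v behind u zeros if r >= v,
  and old row 48 - v + r behind u + 1 zeros otherwise.\<close>

lemma rows_of_mult:
  assumes l: "rows_of p l" and c: "shift_of a c"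
  shows "rows_of ((1 + monom 1 a) * p) (rows_mult c l)"
proof -
  define u v where "u = a div 48" and "v = a mod 48"
  have a: "a = 48 * u + v" and v: "v < 48" by (simp_all add: u_def v_def)
  have len: "length l = 48" "\<And>r. r < 48 \<Longrightarrow> length (l ! r) = 48"
    and nth: "\<And>r t. r < 48 \<Longrightarrow> t < 48 \<Longrightarrow> l ! r ! t = coeff p (48 * t + r)"
    using l by (auto simp: rows_of_def)
  define s where "s = rows_shift c l"
  have s: "s = map ((@) (replicate (Suc u) 0)) (drop (48 - v) l) @ map ((@) (replicate u 0)) (take (48 - v) l)"
    using c by (simp add: s_def shift_of_def utake_eq udrop_eq rows_prepend_eq u_def v_def)
  have len_s: "length s = 48" using v by (simp add: s len)
  have nth_s: "t < length (s ! r) \<and> s ! r ! t = (if a \<le> 48 * t + r then coeff p (48 * t + r - a) else 0)"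
    if rt: "r < 48" "t < 48" for r t
  proof (cases "r < v")
    case True
    hence sr: "s ! r = replicate (Suc u) 0 @ l ! (48 - v + r)"
      using v rt by (simp add: s nth_append len)
    have "48 - v + r < 48" using True v by simp
    note lr = len(2)[OF this] nth[OF this]
    show ?thesis
    proof (cases "t < Suc u")
      case True
      moreover have "\<not> a \<le> 48 * t + r" using True \<open>r < v\<close> by (simp add: a)
      ultimately show ?thesis by (simp add: sr nth_append lr del: replicate_Suc)
    next
      case False
      then obtain k where k: "t = Suc u + k" using le_Suc_ex not_less by blast
      have "48 * t + r - a = 48 * k + (48 - v + r)" "a \<le> 48 * t + r"
        using v \<open>r < v\<close> by (simp_all add: k a)
      thus ?thesis using rt by (simp add: sr nth_append lr k del: replicate_Suc)
    qed
  next
    case False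
    hence sr: "s ! r = replicate u 0 @ l ! (r - v)"
      using v rt by (simp add: s nth_append len)
    have "r - v < 48" using rt by simp
    note lr = len(2)[OF this] nth[OF this]
    show ?thesis
    proof (cases "t < u")
      case True
      moreover have "\<not> a \<le> 48 * t + r" using True rt by (simp add: a)
      ultimately show ?thesis by (simp add: sr nth_append lr)
    next
      case False
      then obtain k where k: "t = u + k" using le_Suc_ex not_less by blast
      have "48 * t + r - a = 48 * k + (r - v)" "a \<le> 48 * t + r"
        using \<open>\<not> r < v\<close> by (simp_all add: k a)
      thus ?thesis using rt by (simp add: sr nth_append lr k)
    qed
  qed
  show ?thesis
    unfolding rows_of_def
    using nth_s by (simp add: len nth len_s nth_rows_add nth_row_add coeff_one_plus_monom_mult flip: s_def)
qed

text \<open>Neighbouring columns are 48 positions apart, doubled to 96. Positions increase along a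
  row, so stopping at the first one beyond h skips nothing relevant.\<close>

lemma row_check_nth:
  "row_check h i xs \<Longrightarrow> t < length xs \<Longrightarrow> i + 96 * int t \<le> h \<Longrightarrow> 0 \<le> xs ! t"
proof (induction h i xs arbitrary: t rule: row_check.induct)
  case (1 h i x xs)
  thus ?case by (cases t) (auto simp: algebra_simps)
qed simp

lemma rows_check_nth:
  "rows_check h i l \<Longrightarrow> r < length l \<Longrightarrow> row_check h (i + 2 * int r) (l ! r)"
proof (induction h i l arbitrary: r rule: rows_check.induct)
  case (1 h i x xs)
  thus ?case by (cases r) (auto simp: algebra_simps)
qed simp

lemma half_nonneg_if_rows_check:
  assumes "rows_of (mdiff m) l" "rows_check (3 * int m * int m + 1) 0 l" "m \<le> 39"
  shows "half_nonneg m"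
  unfolding half_nonneg_def
proof safe
  fix i assume i: "2 * i \<le> 3 * m\<^sup>2 + 1"
  \<comment> \<open>The bound on m enters here: 3 * 39^2 + 1 = 4564, so i <= 2282 < 48^2.\<close>
  have "m\<^sup>2 \<le> 39\<^sup>2" using assms(3) by (intro power_mono) auto
  with i have "i < 48 * 48" by simp
  hence t: "i div 48 < 48" by (rule less_mult_imp_div_less)
  have "2 * int i \<le> 3 * int m * int m + 1"
  proof -
    have "int (2 * i) \<le> int (3 * m\<^sup>2 + 1)" using i by (rule of_nat_mono)
    thus ?thesis by (simp add: power2_eq_square)
  qed
  moreover have "i = 48 * (i div 48) + i mod 48" by simp
  ultimately have "0 + 2 * int (i mod 48) + 96 * int (i div 48) \<le> 3 * int m * int m + 1" by linarith
  moreover have "row_check (3 * int m * int m + 1) (0 + 2 * int (i mod 48)) (l ! (i mod 48))"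
    using assms by (intro rows_check_nth) (simp_all add: rows_of_def)
  ultimately have "0 \<le> l ! (i mod 48) ! (i div 48)"
    using assms(1) t by (intro row_check_nth) (simp_all add: rows_of_def)
  thus "0 \<le> coeff (mdiff m) i" using assms(1) t by (simp add: rows_of_def)
qed

lemma half_nonneg_if_run_check:
  assumes "run_check us (int m) c l" "rows_of (mdiff m) l" "shift_of (3 * m + 1) c"
    "m + length us \<le> 39" "j \<le> length us"
  shows "half_nonneg (m + j)"
  using assms
proof (induction us arbitrary: m c l j)
  case Nil
  thus ?case using half_nonneg_if_rows_check[of m l] by simp
next
  case (Cons u us)
  show ?case
  proof (cases j)
    case 0
    thus ?thesis using Cons.prems half_nonneg_if_rows_check[of m l] by simp
  next
    case (Suc k)
    note c1 = shift_of_Suc[OF Cons.prems(3)]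
    have "rows_of (mdiff (Suc m)) (rows_mult (shift_Suc c) (rows_mult c l))"
      using rows_of_mult[OF rows_of_mult[OF Cons.prems(2,3)] c1]
      by (simp add: mdiff_Suc)
    moreover have "Suc (Suc (Suc (3 * m + 1))) = 3 * Suc m + 1" by simp
    hence "shift_of (3 * Suc m + 1) (shift_Suc (shift_Suc (shift_Suc c)))"
      using shift_of_Suc[OF shift_of_Suc[OF c1]] by (simp only:)
    ultimately have "half_nonneg (Suc m + k)"
      using Cons.prems Suc by (intro Cons.IH) (auto simp: add.commute)
    thus ?thesis using Suc by simp
  qed
qed

definition rows_init :: "int list list" where
  "rows_init = (1 # replicate 47 0) # (- 1 # replicate 47 0) # replicate 46 (replicate 48 0)"

text \<open>A single run checks all M from 0 to 39. It starts with the table of 1 - q and the shift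
  by q^1, hence 47 units.\<close>

lemma run_check_init: "run_check (replicate 39 ()) 0 ([], replicate 47 ()) rows_init"
  by code_simp

lemma rows_of_init: "rows_of (mdiff 0) rows_init"
proof -
  have c: "coeff (mdiff 0) i = (if i = 0 then 1 else if i = 1 then - 1 else 0)" for i
    by (auto simp: mdiff_def mprod_def)
  show ?thesis
    unfolding rows_of_def
  proof (intro conjI allI impI)
    fix r :: nat assume r: "r < 48"
    consider "r = 0" | "r = 1" | k where "r = Suc (Suc k)" by (metis not0_implies_Suc One_nat_def)
    note cases = this
    show "length (rows_init ! r) = 48"
      using r by (cases rule: cases) (simp_all add: rows_init_def)
    fix t :: nat assume "t < 48"
    thus "rows_init ! r ! t = coeff (mdiff 0) (48 * t + r)"
      using r by (cases rule: cases; cases t) (simp_all add: rows_init_def c)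
  qed (simp add: rows_init_def)
qed

lemma half_nonneg_small:
  assumes "m \<le> 39"
  shows "half_nonneg m"
proof -
  have "half_nonneg (0 + m)"
  proof (rule half_nonneg_if_run_check)
    show "run_check (replicate 39 ()) (int 0) ([], replicate 47 ()) rows_init"
      using run_check_init by (simp only: of_nat_0)
    show "shift_of (3 * 0 + 1) ([], replicate 47 ())" by (simp add: shift_of_def)
  qed (use assms rows_of_init in auto)
  thus ?thesis by simp
qed

section \<open>Unimodality\<close>

lemma half_nonneg_Suc:
  assumes "half_nonneg M" and M: "40 \<le> Suc M"
  shows "half_nonneg (Suc M)"
  unfolding half_nonneg_def
proof safe
  fix i assume i: "2 * i \<le> 3 * (Suc M)\<^sup>2 + 1"
  show "0 \<le> coeff (mdiff (Suc M)) i"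
  proof (cases "2 * i \<le> 3 * M\<^sup>2 + 1")
    case True
    \<comment> \<open>The new coefficient is a sum of old ones at indices at most i, all within the
      old lower half.\<close>
    hence "0 \<le> coeff (mdiff M) (i - j)" for j
      using assms(1) by (auto simp: half_nonneg_def)
    note this[of 0, simplified] this[of "3 * M + 1"] this[of "3 * M + 2"]
      this[of "3 * M + 2 + (3 * M + 1)"]
    thus ?thesis
      unfolding mdiff_Suc coeff_one_plus_monom_mult diff_diff_left by simp
  next
    case False
    define s where "s = 3 * real (Suc M) ^ 2 + 1 - 2 * real i"
    have s: "s = real (3 * (Suc M)\<^sup>2 + 1 - 2 * i)"
      using i by (simp add: s_def of_nat_diff)
    \<comment> \<open>Past the old middle, s is at most 3(M+1)^2 + 1 - (3M^2 + 2) = 6M + 2, within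
      the range of the integral estimate.\<close>
    have "3 * M\<^sup>2 + 2 \<le> 2 * i" using False by simp
    hence "3 * (Suc M)\<^sup>2 + 1 - 2 * i \<le> 6 * M + 2"
      by (simp add: power2_eq_square)
    hence "s \<le> real (6 * M + 2)" unfolding s of_nat_le_iff .
    hence "s \<le> 6 * real (Suc M) - 2" by simp
    \<comment> \<open>s is a natural number, so it avoids the open interval from 0 to 1.\<close>
    moreover have "s = 0 \<or> 1 \<le> s" unfolding s by (cases "3 * (Suc M)\<^sup>2 + 1 - 2 * i") auto
    ultimately have "0 \<le> integral {0..pi / 2} (\<lambda>x. cos_prod (Suc M) x * sin x * sin (s * x))"
      by (rule integral_cos_prod_nonneg[OF M])
    hence "0 \<le> of_int (coeff (mdiff (Suc M)) i) * (pi / 2)"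
      unfolding coeff_mdiff_integral s_def by simp
    thus ?thesis using pi_gt_zero by (auto simp: zero_le_mult_iff)
  qed
qed

lemma half_nonneg: "half_nonneg M"
proof (cases "M \<le> 39")
  case True
  thus ?thesis by (rule half_nonneg_small)
next
  case False
  hence "39 \<le> M" by simp
  thus ?thesis
    by (induction M rule: dec_induct) (auto intro: half_nonneg_small half_nonneg_Suc)
qed

lemma coeff_mprod_mono:
  assumes "2 * Suc i \<le> 3 * M\<^sup>2 + 1"
  shows "coeff (mprod M) i \<le> coeff (mprod M) (Suc i)"
proof -
  have "0 \<le> coeff (mdiff M) (Suc i)"
    using half_nonneg[of M] assms unfolding half_nonneg_def by blast
  thus ?thesis by (simp add: coeff_mdiff_Suc)
qed

theorem theorem1p2:
  fixes n :: nat and P :: "int poly"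
  defines "P \<equiv> (\<Prod>k=0..n. (1 + monom 1 (3 * k + 1)) * (1 + monom 1 (3 * k + 2)))"
  shows "symmetric_poly P \<and> unimodal_poly P"
proof -
  define M where "M = Suc n"
  define N where "N = 3 * M\<^sup>2"
  have P: "P = mprod M"
    by (simp add: P_def mprod_def M_def atLeast0AtMost lessThan_Suc_atMost)
  have deg: "degree P = N" by (simp add: P degree_mprod N_def)
  have sym: "coeff P (N - i) = coeff P i" if "i \<le> N" for i
    using coeff_mprod_sym[of i M] that by (simp add: P N_def)
  have mono: "coeff P i \<le> coeff P (i + 1)" if "2 * Suc i \<le> N + 1" for i
    using coeff_mprod_mono[of i M] that by (simp add: P N_def)
  have anti: "coeff P (i + 1) \<le> coeff P i" if "N div 2 \<le> i" "i < N" for i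
  proof -
    \<comment> \<open>Hence the reflected index N - (i + 1) lies in the range of
      \<open>mono\<close>. For odd N and i = \<open>N div 2\<close> it is i itself, and the two
      middle coefficients are compared.\<close>
    have "N \<le> 2 * i + 1" using that(1) by presburger
    hence "coeff P (N - (i + 1)) \<le> coeff P (N - (i + 1) + 1)"
      using that(2) by (intro mono) simp
    also have "N - (i + 1) + 1 = N - i" using that by simp
    finally show ?thesis using sym[of i] sym[of "i + 1"] that by simp
  qed
  have "symmetric_poly P"
    using sym by (simp add: symmetric_poly_def deg)
  moreover have "unimodal_poly P"
    unfolding unimodal_poly_def deg
  proof (intro exI[of _ "N div 2"] conjI allI impI)
    show "coeff P i \<le> coeff P (i + 1)" if "i < N div 2" for i
      using that by (intro mono) simp
  qed (use anti in auto)
  ultimately show ?thesis ..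
qed

end
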